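(* Let $N\in\{1,2,\dots\}$, $\beta_1,\beta_2>0$, and consider the entropy-regularized $N$-stage game with evaluation function $\Phi_N(\boldsymbol{\sigma},\boldsymbol{\tau})$ and initial distribution $\mu_1\in\Delta(\mathcal{X})$. Markovian strategies are sufficient for both players to attain, if it exists, the value of the game, i.e., $$\max_{\boldsymbol{\sigma}\in\Gamma_1^M}\ \min_{\boldsymbol{\tau}\in\Gamma_2^M}\Phi_N(\boldsymbol{\sigma},\boldsymbol{\tau})=\max_{\boldsymbol{\sigma}\in\Gamma_1}\ \min_{\boldsymbol{\tau}\in\Gamma_2}\Phi_N(\boldsymbol{\sigma},\boldsymbol{\tau}),$$ $$\min_{\boldsymbol{\tau}\in\Gamma_2^M}\ \max_{\boldsymbol{\sigma}\in\Gamma_1^M}\Phi_N(\boldsymbol{\sigma},\boldsymbol{\tau})=\min_{\boldsymbol{\tau}\in\Gamma_2}\ \max_{\boldsymbol{\sigma}\in\Gamma_1}\Phi_N(\boldsymbol{\sigma},\boldsymbol{\tau}).$$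
   Context: **Game.** $\mathcal{X}$ (states), $\mathcal{U}$ (actions of player 1), $\mathcal{W}$ (actions of player 2) are finite nonempty sets; $\Delta(S)$ is the probability simplex over a finite set $S$. The transition kernel is $\mathcal{P}:\mathcal{X}\times\mathcal{U}\times\mathcal{W}\to\Delta(\mathcal{X})$, written $\mathcal{P}(x'|x,u,w)$. The stage payoff (made by player 2 to player 1) is a real-valued function $\mathcal{R}(x,u,w)$, and there is a real-valued terminal payoff, also denoted $\mathcal{R}(x)$, $x\in\mathcal{X}$. At each stage $t$ both players observe the current state and simultaneously choose actions $u_t,w_t$; the next state is drawn from $\mathcal{P}(\cdot|x_t,u_t,w_t)$. Player 1 maximizes and player 2 minimizes the evaluation function. **Strategies.** For a sequence, $x^t=(x_1,\dots,x_t)$. The set of histories up to stage $t$ is $\mathcal{H}_t=(\mathcal{X}\times\mathcal{U}\times\mathcal{W})^{t-1}\times\mathcal{X}$, with elements $h_t=(x^t,u^{t-1},w^{t-1})$. A strategy of player 1 is $\boldsymbol{\sigma}=(\sigma_1,\sigma_2,\dots)$ with $\sigma_t:\mathcal{H}_t\to\Delta(\mathcal{U})$; a strategy of player 2 is $\boldsymbol{\tau}=(\tau_1,\tau_2,\dots)$ with $\tau_t:\mathcal{H}_t\to\Delta(\mathcal{W})$ (in an $N$-stage game only $t=1,\dots,N$ matter). A strategy is Markovian if each $\sigma_t$ (resp. $\tau_t$) depends on $h_t$ only through the current state $x_t$. $\Gamma_i$ and $\Gamma_i^M$ denote the sets of all strategies and all Markovian strategies of player $i\in\{1,2\}$. **Induced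 distribution.** Given $\mu_1\in\Delta(\mathcal{X})$ and $(\boldsymbol{\sigma},\boldsymbol{\tau})$, the distribution of histories is defined by $\mu_{t+1}(x^{t+1},u^t,w^t)=\mathcal{P}(x_{t+1}|x_t,u_t,w_t)\,\sigma_t(u_t|h_t)\,\tau_t(w_t|h_t)\,\mu_t(h_t)$. All random variables $X_t,U_t,W_t$ below have this joint law; $\mathbb{E}$ denotes the corresponding expectation. **Evaluation function.** With natural logarithms, $0\log 0=0$, and $H(\cdot|\cdot)$ the conditional Shannon entropy, $$\Phi_N(\boldsymbol{\sigma},\boldsymbol{\tau})=\sum_{t=1}^N\mathbb{E}\,\mathcal{R}(X_t,U_t,W_t)+\mathbb{E}\,\mathcal{R}(X_{N+1})+\frac1{\beta_1}\sum_{t=1}^N H(U_t|X^t,U^{t-1},W^{t-1})-\frac1{\beta_2}\sum_{t=1}^N H(W_t|X^t,U^{t-1},W^{t-1}).$$ (The two sums of entropies are the causal entropies $H(U^N\|X^N,W^{N-1})$ and $H(W^N\|X^N,U^{N-1})$.) The game has a value if $\max_{\boldsymbol{\sigma}\in\Gamma_1}\min_{\boldsymbol{\tau}\in\Gamma_2}\Phi_N=\min_{\boldsymbol{\tau}\in\Gamma_2}\max_{\boldsymbol{\sigma}\in\Gamma_1}\Phi_N$, and the value is this common number. *)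

theory Defs
  imports "HOL-Probability.Probability"
begin

text \<open>
  A history up to stage \<open>t\<close> is the list of the \<open>t - 1\<close> completed stages, oldest first, paired with
  the current state. Stages are numbered from 1.
\<close>

type_synonym ('x, 'u, 'w) history = "('x \<times> 'u \<times> 'w) list \<times> 'x"

definition histories :: "nat \<Rightarrow> ('x, 'u, 'w) history set" where
  "histories t = {h. length (fst h) = t - 1}"

text \<open>
  For a strategy \<open>\<sigma>\<close>, only the values \<open>\<sigma> t h\<close> with \<open>1 \<le> t\<close> and \<open>h \<in> histories t\<close> are meaningful;
  the evaluation function does not depend on the others, so every function of this type counts
  as a strategy.
\<close>

type_synonym ('x, 'u, 'w, 'a) strategy = "nat \<Rightarrow> ('x, 'u, 'w) history \<Rightarrow> 'a pmf"

abbreviation strategies :: "('x, 'u, 'w, 'a) strategy set" where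
  "strategies \<equiv> UNIV"

definition markov_strategies :: "('x, 'u, 'w, 'a) strategy set" where
  "markov_strategies =
     {\<sigma>. \<forall>t\<ge>1. \<forall>h\<in>histories t. \<forall>h'\<in>histories t. snd h = snd h' \<longrightarrow> \<sigma> t h = \<sigma> t h'}"

text \<open>\<open>history_law \<dots> n\<close> is the law of the history up to stage \<open>n + 1\<close>, after \<open>n\<close> completed stages.\<close>

primrec history_law ::
  "('x \<Rightarrow> 'u \<Rightarrow> 'w \<Rightarrow> 'x pmf) \<Rightarrow> 'x pmf \<Rightarrow> ('x, 'u, 'w, 'u) strategy \<Rightarrow> ('x, 'u, 'w, 'w) strategy
    \<Rightarrow> nat \<Rightarrow> ('x, 'u, 'w) history pmf" where
  "history_law P \<mu> \<sigma> \<tau> 0 = map_pmf (\<lambda>x. ([], x)) \<mu>"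
| "history_law P \<mu> \<sigma> \<tau> (Suc n) =
     bind_pmf (history_law P \<mu> \<sigma> \<tau> n) (\<lambda>h.
     bind_pmf (\<sigma> (Suc n) h) (\<lambda>u.
     bind_pmf (\<tau> (Suc n) h) (\<lambda>w.
     map_pmf (\<lambda>x'. (fst h @ [(snd h, u, w)], x')) (P (snd h) u w))))"

lemma expectation_indicator_pmf:
  "measure_pmf.expectation p (\<lambda>a. indicator {b} a * c) = pmf p b * (c :: real)"
  "measure_pmf.expectation p (\<lambda>a. d * (indicator {b} a * c)) = d * (pmf p b * c)"
  by (simp_all add: measure_pmf_single)

lemma pmf_history_law_Suc:
  fixes P :: "'x::finite \<Rightarrow> 'u::finite \<Rightarrow> 'w::finite \<Rightarrow> 'x pmf"
  shows "pmf (history_law P \<mu> \<sigma> \<tau> (Suc n)) (l @ [(x, u, w)], x') =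
    pmf (P x u w) x' * pmf (\<sigma> (Suc n) (l, x)) u * pmf (\<tau> (Suc n) (l, x)) w
      * pmf (history_law P \<mu> \<sigma> \<tau> n) (l, x)"
proof -
  let ?z = "(l @ [(x, u, w)], x')"
  have inner: "pmf (map_pmf (\<lambda>y. (fst h @ [(snd h, a, b)], y)) (P (snd h) a b)) ?z =
      indicator {(l, x)} h * (indicator {u} a * (indicator {w} b * pmf (P x u w) x'))" for h a b
  proof (cases "h = (l, x) \<and> a = u \<and> b = w")
    case True
    have "inj (\<lambda>y. (l @ [(x, u, w)], y))" by (auto simp: inj_on_def)
    from pmf_map_inj'[OF this, of "P x u w" x'] show ?thesis using True by simp
  next
    case False
    then have "?z \<notin> set_pmf (map_pmf (\<lambda>y. (fst h @ [(snd h, a, b)], y)) (P (snd h) a b))"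
      by (cases h) auto
    then have "pmf (map_pmf (\<lambda>y. (fst h @ [(snd h, a, b)], y)) (P (snd h) a b)) ?z = 0"
      by (simp only: set_pmf_iff not_not)
    then show ?thesis using False by (auto simp: indicator_def)
  qed
  have w: "pmf (bind_pmf (\<tau> (Suc n) h) (\<lambda>b.
        map_pmf (\<lambda>y. (fst h @ [(snd h, a, b)], y)) (P (snd h) a b))) ?z =
      indicator {(l, x)} h * (indicator {u} a * (pmf (\<tau> (Suc n) (l, x)) w * pmf (P x u w) x'))" for h a
    unfolding pmf_bind inner
    by (cases "h = (l, x)") (simp_all only: expectation_indicator_pmf, simp_all add: measure_pmf_single)
  have u: "pmf (bind_pmf (\<sigma> (Suc n) h) (\<lambda>a. bind_pmf (\<tau> (Suc n) h) (\<lambda>b.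
        map_pmf (\<lambda>y. (fst h @ [(snd h, a, b)], y)) (P (snd h) a b)))) ?z =
      indicator {(l, x)} h * (pmf (\<sigma> (Suc n) (l, x)) u * (pmf (\<tau> (Suc n) (l, x)) w * pmf (P x u w) x'))" for h
    unfolding pmf_bind[of "\<sigma> (Suc n) h"] w
    by (cases "h = (l, x)") (simp_all only: expectation_indicator_pmf, simp_all add: measure_pmf_single)
  show ?thesis
    unfolding history_law.simps pmf_bind[of "history_law P \<mu> \<sigma> \<tau> n"] u expectation_indicator_pmf
    by simp
qed

text \<open>
  Random variables on complete play records: the history up to stage \<open>t\<close>, the state and the two
  actions of stage \<open>t\<close>. On a history with \<open>N\<close> completed stages they are meaningful for
  \<open>1 \<le> t \<le> N + 1\<close> (history, state) and \<open>1 \<le> t \<le> N\<close> (actions).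
\<close>

definition history_at :: "nat \<Rightarrow> ('x, 'u, 'w) history \<Rightarrow> ('x, 'u, 'w) history" where
  "history_at t h = (take (t - 1) (fst h), (map fst (fst h) @ [snd h]) ! (t - 1))"

definition state_at :: "nat \<Rightarrow> ('x, 'u, 'w) history \<Rightarrow> 'x" where
  "state_at t h = snd (history_at t h)"

definition action1_at :: "nat \<Rightarrow> ('x, 'u, 'w) history \<Rightarrow> 'u" where
  "action1_at t h = fst (snd (fst h ! (t - 1)))"

definition action2_at :: "nat \<Rightarrow> ('x, 'u, 'w) history \<Rightarrow> 'w" where
  "action2_at t h = snd (snd (fst h ! (t - 1)))"

definition cond_entropy_pmf :: "'z pmf \<Rightarrow> ('z \<Rightarrow> 'a) \<Rightarrow> ('z \<Rightarrow> 'b) \<Rightarrow> real" where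
  "cond_entropy_pmf p A B =
     prob_space.conditional_entropy (measure_pmf p) (exp 1) (count_space UNIV) (count_space UNIV) A B"

lemma cond_entropy_pmf_eq:
  fixes p :: "'z pmf" and A :: "'z \<Rightarrow> 'a::countable" and B :: "'z \<Rightarrow> 'b::countable"
  shows "cond_entropy_pmf p A B =
    - measure_pmf.expectation (map_pmf (\<lambda>z. (A z, B z)) p)
        (\<lambda>(a, b). ln (pmf (map_pmf (\<lambda>z. (A z, B z)) p) (a, b) / pmf (map_pmf B p) b))"
proof -
  have pr: "count_space UNIV \<Otimes>\<^sub>M count_space UNIV = (count_space UNIV :: ('a \<times> 'b) measure)"
    by (subst pair_measure_countable) auto
  have RN: "enn2real (RN_deriv (count_space UNIV) (measure_pmf q) x) = pmf q x"
    for q :: "'c::countable pmf" and x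
  proof -
    interpret sigma_finite_measure "count_space (UNIV :: 'c set)"
      by (rule sigma_finite_measure_count_space)
    have "AE y in count_space UNIV. ennreal (pmf q y) = RN_deriv (count_space UNIV) (measure_pmf q) y"
      by (rule RN_deriv_unique) (auto simp: measure_pmf_eq_density[symmetric])
    then have "ennreal (pmf q x) = RN_deriv (count_space UNIV) (measure_pmf q) x"
      by (simp add: AE_count_space)
    then show ?thesis by (metis enn2real_ennreal pmf_nonneg)
  qed
  have d: "distr (measure_pmf p) (count_space UNIV) f = measure_pmf (map_pmf f p)" for f :: "'z \<Rightarrow> 'c"
    by (simp add: map_pmf_rep_eq)
  show ?thesis
    unfolding cond_entropy_pmf_def prob_space.conditional_entropy_def[OF prob_space_measure_pmf] pr d RN
    by (simp add: log_def)
qed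

definition evaluation ::
  "('x \<Rightarrow> 'u \<Rightarrow> 'w \<Rightarrow> 'x pmf) \<Rightarrow> ('x \<Rightarrow> 'u \<Rightarrow> 'w \<Rightarrow> real) \<Rightarrow> ('x \<Rightarrow> real) \<Rightarrow> 'x pmf \<Rightarrow> real \<Rightarrow> real
    \<Rightarrow> nat \<Rightarrow> ('x, 'u, 'w, 'u) strategy \<Rightarrow> ('x, 'u, 'w, 'w) strategy \<Rightarrow> real" where
  "evaluation P R K \<mu> \<beta>1 \<beta>2 N \<sigma> \<tau> =
     (let p = history_law P \<mu> \<sigma> \<tau> N in
       (\<Sum>t=1..N. measure_pmf.expectation p (\<lambda>h. R (state_at t h) (action1_at t h) (action2_at t h)))
       + measure_pmf.expectation p (\<lambda>h. K (state_at (N + 1) h))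
       + 1 / \<beta>1 * (\<Sum>t=1..N. cond_entropy_pmf p (action1_at t) (history_at t))
       - 1 / \<beta>2 * (\<Sum>t=1..N. cond_entropy_pmf p (action2_at t) (history_at t)))"

text \<open>
  Maxima and minima over infinite sets, as relations: they include the claim that the extremum
  is attained, and determine the extremal value uniquely.
\<close>

definition is_max_over :: "('s \<Rightarrow> real) \<Rightarrow> 's set \<Rightarrow> real \<Rightarrow> bool" where
  "is_max_over f A v \<longleftrightarrow> v \<in> f ` A \<and> (\<forall>a\<in>A. f a \<le> v)"

definition is_min_over :: "('s \<Rightarrow> real) \<Rightarrow> 's set \<Rightarrow> real \<Rightarrow> bool" where
  "is_min_over f A v \<longleftrightarrow> v \<in> f ` A \<and> (\<forall>a\<in>A. v \<le> f a)"

definition is_max_min :: "('s \<Rightarrow> 't \<Rightarrow> real) \<Rightarrow> 's set \<Rightarrow> 't set \<Rightarrow> real \<Rightarrow> bool" where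
  "is_max_min f A B v \<longleftrightarrow>
     (\<exists>g. (\<forall>\<sigma>\<in>A. is_min_over (\<lambda>\<tau>. f \<sigma> \<tau>) B (g \<sigma>)) \<and> is_max_over g A v)"

definition is_min_max :: "('s \<Rightarrow> 't \<Rightarrow> real) \<Rightarrow> 's set \<Rightarrow> 't set \<Rightarrow> real \<Rightarrow> bool" where
  "is_min_max f A B v \<longleftrightarrow>
     (\<exists>g. (\<forall>\<tau>\<in>B. is_max_over (\<lambda>\<sigma>. f \<sigma> \<tau>) A (g \<tau>)) \<and> is_min_over g B v)"

end

theory Submission
  imports Defs "HOL-Real_Asymp.Real_Asymp"
begin

text \<open>
  The value of the unrestricted max-min problem is computed by a recursion over states, and the
  strategies read off from this recursion are Markovian.

  The evaluation function is an expected sum of stage payoffs: the conditional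
  entropy of the action of stage \<open>t\<close> given the history is the expected entropy of the mixed action
  prescribed there (\<open>cond_entropy_pmf_kernel\<close>, \<open>stage_law\<close>). A stage is therefore a matrix
  game with payoff \<open>p M q + H p / \<beta>1 - H q / \<beta>2\<close>, and the evaluation satisfies a backward recursion
  in which the expected continuation is added to the matrix (\<open>evaluation_eq_backward_value\<close>).

  In a single matrix game the minimum over \<open>q\<close> is given by a Gibbs distribution and is an explicit
  continuous function of \<open>p\<close>, so compactness of the simplex provides a maximizing \<open>p\<close>
  (\<open>regularized_payoff_max_min\<close>). These one-stage optima are put together in
  \<open>is_max_min_backward_value\<close>. Against a fixed strategy \<open>\<sigma>\<close>, backward induction yields a
  best reply, which is Markovian if \<open>\<sigma>\<close> is. By monotonicity of the recursion, no \<open>\<sigma>\<close>,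
  however it uses the past, guarantees more than the max-min recursion over states, and a Markovian
  strategy guarantees that much. The min-max problem is the max-min problem of the
  negated game with the players exchanged (\<open>is_min_max_iff_dual\<close>, \<open>regularized_payoff_swap\<close>).
\<close>

section \<open>Entropy-regularized matrix games\<close>

definition shannon_entropy :: "'a::finite pmf \<Rightarrow> real" where
  "shannon_entropy p = - (\<Sum>a\<in>UNIV. pmf p a * ln (pmf p a))"

definition bilinear_payoff :: "('u::finite \<Rightarrow> 'w::finite \<Rightarrow> real) \<Rightarrow> 'u pmf \<Rightarrow> 'w pmf \<Rightarrow> real" where
  "bilinear_payoff M p q = (\<Sum>u\<in>UNIV. \<Sum>w\<in>UNIV. pmf p u * pmf q w * M u w)"

definition regularized_payoff ::
  "real \<Rightarrow> real \<Rightarrow> ('u::finite \<Rightarrow> 'w::finite \<Rightarrow> real) \<Rightarrow> 'u pmf \<Rightarrow> 'w pmf \<Rightarrow> real" where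
  "regularized_payoff \<beta>1 \<beta>2 M p q =
     bilinear_payoff M p q + shannon_entropy p / \<beta>1 - shannon_entropy q / \<beta>2"

lemma sum_pmf_finite_type: "(\<Sum>a\<in>UNIV. pmf (p :: 'a::finite pmf) a) = 1"
  by (rule sum_pmf_eq_1) auto

lemma bilinear_payoff_add:
  "bilinear_payoff (\<lambda>u w. A u w + B u w) p q = bilinear_payoff A p q + bilinear_payoff B p q"
  unfolding bilinear_payoff_def by (simp add: distrib_left sum.distrib)

lemma bilinear_payoff_mono:
  "(\<And>u w. A u w \<le> B u w) \<Longrightarrow> bilinear_payoff A p q \<le> bilinear_payoff B p q"
  unfolding bilinear_payoff_def by (intro sum_mono mult_left_mono) auto

lemma bilinear_payoff_swap: "bilinear_payoff (\<lambda>w u. - M u w) q p = - bilinear_payoff M p q"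
  unfolding bilinear_payoff_def sum_negf[symmetric]
  by (subst sum.swap) (simp add: mult.commute mult.left_commute)

text \<open>
  Exchanging the players negates the payoff, because the entropies enter with opposite signs. Every
  result about player 1 thus has a mirror image for player 2.
\<close>
lemma regularized_payoff_swap:
  "regularized_payoff \<beta>2 \<beta>1 (\<lambda>w u. - M u w) q p = - regularized_payoff \<beta>1 \<beta>2 M p q"
  unfolding regularized_payoff_def bilinear_payoff_swap by simp

text \<open>
  Summing \<open>p ln (q / p) \<le> q - p\<close>, an instance of \<open>ln z \<le> z - 1\<close>, over all points leaves \<open>0\<close> on the
  right, since both mass functions have total \<open>1\<close>.
\<close>
lemma gibbs_inequality:
  fixes p q :: "'a::finite pmf"
  assumes "\<And>a. pmf q a > 0"
  shows "shannon_entropy p \<le> - (\<Sum>a\<in>UNIV. pmf p a * ln (pmf q a))"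
proof -
  have "pmf p a * ln (pmf q a) - pmf p a * ln (pmf p a) \<le> pmf q a - pmf p a" for a
  proof (cases "pmf p a = 0")
    case False
    then have p: "pmf p a > 0" by (simp add: pmf_pos)
    have "pmf p a * (ln (pmf q a) - ln (pmf p a)) = pmf p a * ln (pmf q a / pmf p a)"
      using p assms[of a] by (simp add: ln_div)
    also have "\<dots> \<le> pmf p a * (pmf q a / pmf p a - 1)"
      using p assms[of a] by (intro mult_left_mono ln_le_minus_one) auto
    also have "\<dots> = pmf q a - pmf p a"
      using p by (simp add: field_simps)
    finally show ?thesis by (simp add: algebra_simps)
  qed simp
  then have "(\<Sum>a\<in>UNIV. pmf p a * ln (pmf q a) - pmf p a * ln (pmf p a)) \<le>
      (\<Sum>a\<in>UNIV. pmf q a - pmf p a)"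
    by (rule sum_mono)
  then show ?thesis
    by (simp add: sum_subtractf sum_pmf_finite_type shannon_entropy_def)
qed

lemma ex_pmf_with_masses:
  fixes f :: "'a::finite \<Rightarrow> real"
  assumes "\<And>a. f a \<ge> 0" "(\<Sum>a\<in>UNIV. f a) = 1"
  obtains p where "\<And>a. pmf p a = f a"
proof
  fix a
  show "pmf (embed_pmf f) a = f a"
    using assms by (intro pmf_embed_pmf) (auto simp: nn_integral_count_space_finite)
qed

text \<open>
  The minimizer is the Gibbs distribution, with masses proportional to \<open>exp (- \<beta> a)\<close>: with respect
  to it the cross entropy of any \<open>q'\<close> is an affine function of the expectation of \<open>a\<close> under \<open>q'\<close>,
  so the bound is Gibbs' inequality. The explicit minimum is what makes the payoff left by a
  best reply of player 2 continuous in the mixed action of player 1.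
\<close>
lemma entropic_minimum:
  fixes a :: "'w::finite \<Rightarrow> real"
  assumes "\<beta> > 0"
  obtains q where
    "(\<Sum>w\<in>UNIV. pmf q w * a w) - shannon_entropy q / \<beta> = - ln (\<Sum>w\<in>UNIV. exp (- \<beta> * a w)) / \<beta>"
    "\<And>q'. - ln (\<Sum>w\<in>UNIV. exp (- \<beta> * a w)) / \<beta> \<le> (\<Sum>w\<in>UNIV. pmf q' w * a w) - shannon_entropy q' / \<beta>"
proof -
  define Z where "Z = (\<Sum>w\<in>UNIV. exp (- \<beta> * a w))"
  have Z: "Z > 0" unfolding Z_def by (rule sum_pos) auto
  obtain q where q: "\<And>w. pmf q w = exp (- \<beta> * a w) / Z"
    by (rule ex_pmf_with_masses[of "\<lambda>w. exp (- \<beta> * a w) / Z"])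
      (use Z in \<open>auto simp: sum_divide_distrib[symmetric] Z_def\<close>)
  have lnq: "ln (pmf q w) = - \<beta> * a w - ln Z" for w
    using Z by (simp add: q ln_div)
  have cross: "- (\<Sum>w\<in>UNIV. pmf q' w * ln (pmf q w)) = \<beta> * (\<Sum>w\<in>UNIV. pmf q' w * a w) + ln Z" for q'
  proof -
    have "- (\<Sum>w\<in>UNIV. pmf q' w * ln (pmf q w)) = (\<Sum>w\<in>UNIV. \<beta> * (pmf q' w * a w) + pmf q' w * ln Z)"
      unfolding lnq sum_negf[symmetric] by (simp add: algebra_simps)
    also have "\<dots> = \<beta> * (\<Sum>w\<in>UNIV. pmf q' w * a w) + ln Z"
      by (simp add: sum.distrib sum_distrib_left[symmetric] sum_distrib_right[symmetric] sum_pmf_finite_type)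
    finally show ?thesis .
  qed
  have "(\<Sum>w\<in>UNIV. pmf q w * a w) - shannon_entropy q / \<beta> = - ln Z / \<beta>"
    using assms cross[of q] by (simp add: shannon_entropy_def field_simps)
  moreover have "- ln Z / \<beta> \<le> (\<Sum>w\<in>UNIV. pmf q' w * a w) - shannon_entropy q' / \<beta>" for q'
  proof -
    have "shannon_entropy q' \<le> \<beta> * (\<Sum>w\<in>UNIV. pmf q' w * a w) + ln Z"
      using gibbs_inequality[of q q'] Z by (simp add: cross[symmetric] q)
    then show ?thesis using assms by (simp add: field_simps)
  qed
  ultimately show ?thesis using that[of q] unfolding Z_def by blast
qed

lemma continuous_on_x_ln_x: "continuous_on {0..} (\<lambda>x::real. x * ln x)"
proof (rule continuous_on_eq_continuous_within[THEN iffD2], rule ballI)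
  fix x :: real assume "x \<in> {0..}"
  show "continuous (at x within {0..}) (\<lambda>x. x * ln x)"
  proof (cases "x = 0")
    case True
    have "((\<lambda>x::real. x * ln x) \<longlongrightarrow> 0) (at_right 0)" by real_asymp
    then have "((\<lambda>x::real. x * ln x) \<longlongrightarrow> 0) (at 0 within {0..})"
      by (simp add: at_within_Ici_at_right)
    then show ?thesis using True by (simp add: continuous_within)
  next
    case False
    then show ?thesis by (intro continuous_intros) auto
  qed
qed

text \<open>
  The mass functions on a finite type form a simplex, which is compact as a closed subset of the
  unit cube.
\<close>
lemma pmf_attains_sup:
  fixes f :: "real ^ 'u::finite \<Rightarrow> real"
  assumes "continuous_on {v. \<forall>u. v $ u \<ge> 0} f"
  obtains p where "\<And>p'. f (\<chi> u. pmf p' u) \<le> f (\<chi> u. pmf p u)"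
proof -
  define S :: "(real ^ 'u) set" where "S = {v. (\<forall>u. v $ u \<ge> 0) \<and> (\<Sum>u\<in>UNIV. v $ u) = 1}"
  have "closed S"
    unfolding S_def
    by (intro closed_Collect_conj closed_Collect_all closed_Collect_le closed_Collect_eq continuous_intros)
  moreover have "S \<subseteq> cbox 0 1"
  proof
    fix v assume v: "v \<in> S"
    have "v $ u \<le> 1" for u
      using v member_le_sum[of u UNIV "\<lambda>u. v $ u"] by (auto simp: S_def)
    then show "v \<in> cbox 0 1" using v by (auto simp: S_def mem_box_cart)
  qed
  ultimately have "compact S"
    using compact_Int_closed[OF compact_cbox[of 0 "1 :: real ^ 'u"], of S] by (simp add: Int_absorb1)
  moreover have pmf_in: "(\<chi> u. pmf p u) \<in> S" for p
    by (simp add: S_def sum_pmf_finite_type)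
  moreover have "continuous_on S f"
    by (rule continuous_on_subset[OF assms]) (auto simp: S_def)
  ultimately obtain v where v: "v \<in> S" "\<And>v'. v' \<in> S \<Longrightarrow> f v' \<le> f v"
    using continuous_attains_sup[of S f] by blast
  obtain p where "\<And>u. pmf p u = v $ u"
    by (rule ex_pmf_with_masses[of "\<lambda>u. v $ u"]) (use v(1) in \<open>auto simp: S_def\<close>)
  then have "(\<chi> u. pmf p u) = v" by (simp add: vec_eq_iff)
  then show ?thesis using that[of p] v(2)[OF pmf_in] by simp
qed

text \<open>
  For fixed \<open>p\<close>, player 2 faces the linear cost \<open>w \<mapsto> \<Sum>u. p u * M u w\<close>.
\<close>
lemma bilinear_payoff_commute:
  "bilinear_payoff M p q = (\<Sum>w\<in>UNIV. pmf q w * (\<Sum>u\<in>UNIV. pmf p u * M u w))"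
  unfolding bilinear_payoff_def
  by (subst sum.swap) (simp add: sum_distrib_left mult.commute mult.left_commute)

lemma regularized_payoff_attains_min:
  fixes M :: "'u::finite \<Rightarrow> 'w::finite \<Rightarrow> real" and \<beta>1 \<beta>2 :: real
  assumes "\<beta>2 > 0"
  defines "m \<equiv> \<lambda>p. shannon_entropy p / \<beta>1
    - ln (\<Sum>w\<in>UNIV. exp (- \<beta>2 * (\<Sum>u\<in>UNIV. pmf p u * M u w))) / \<beta>2"
  obtains q where "regularized_payoff \<beta>1 \<beta>2 M p q = m p"
    "\<And>q'. m p \<le> regularized_payoff \<beta>1 \<beta>2 M p q'"
proof -
  obtain q where q:
    "(\<Sum>w\<in>UNIV. pmf q w * (\<Sum>u\<in>UNIV. pmf p u * M u w)) - shannon_entropy q / \<beta>2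
      = m p - shannon_entropy p / \<beta>1"
    "\<And>q'. m p - shannon_entropy p / \<beta>1
      \<le> (\<Sum>w\<in>UNIV. pmf q' w * (\<Sum>u\<in>UNIV. pmf p u * M u w)) - shannon_entropy q' / \<beta>2"
    by (rule entropic_minimum[OF assms(1), of "\<lambda>w. \<Sum>u\<in>UNIV. pmf p u * M u w"]) (auto simp: m_def)
  show ?thesis
  proof (rule that)
    show "regularized_payoff \<beta>1 \<beta>2 M p q = m p"
      using q(1) by (simp add: regularized_payoff_def bilinear_payoff_commute)
    show "m p \<le> regularized_payoff \<beta>1 \<beta>2 M p q'" for q'
      using q(2)[of q'] by (simp add: regularized_payoff_def bilinear_payoff_commute)
  qed
qed

lemma regularized_payoff_min:
  assumes "\<beta>2 > 0"
  shows "\<exists>q. \<forall>q'. regularized_payoff \<beta>1 \<beta>2 M p q \<le> regularized_payoff \<beta>1 \<beta>2 M p q'"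
  by (rule regularized_payoff_attains_min[OF assms, where M = M and p = p and ?\<beta>1.0 = \<beta>1]) metis

text \<open>
  After the minimum over \<open>q\<close> has been evaluated, the remaining function of \<open>p\<close> is a multiple of the
  entropy of \<open>p\<close> plus a smooth term, hence continuous up to the boundary of the simplex, and it attains its maximum.
  The conclusion is phrased without naming the max-min value: it is the payoff at \<open>(p, q)\<close>, where
  \<open>q\<close> is a best reply to \<open>p\<close> and no other \<open>p'\<close> guarantees more.
\<close>
lemma regularized_payoff_max_min:
  fixes M :: "'u::finite \<Rightarrow> 'w::finite \<Rightarrow> real"
  assumes "\<beta>2 > 0"
  shows "\<exists>p q. (\<forall>q'. regularized_payoff \<beta>1 \<beta>2 M p q \<le> regularized_payoff \<beta>1 \<beta>2 M p q') \<and>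
    (\<forall>p'. \<exists>q'. regularized_payoff \<beta>1 \<beta>2 M p' q' \<le> regularized_payoff \<beta>1 \<beta>2 M p q)"
proof -
  define f :: "real ^ 'u \<Rightarrow> real" where
    "f v = - (\<Sum>u\<in>UNIV. v $ u * ln (v $ u)) / \<beta>1
      - ln (\<Sum>w\<in>UNIV. exp (- \<beta>2 * (\<Sum>u\<in>UNIV. v $ u * M u w))) / \<beta>2" for v
  have "continuous_on {v. \<forall>u. v $ u \<ge> 0} f"
  proof -
    have "continuous_on {v. \<forall>u. v $ u \<ge> 0} (\<lambda>v :: real ^ 'u. \<Sum>u\<in>UNIV. v $ u * ln (v $ u))"
      by (intro continuous_on_sum continuous_on_compose2[OF continuous_on_x_ln_x])
        (auto intro!: continuous_intros)
    moreover have "continuous_on {v. \<forall>u. v $ u \<ge> 0}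
        (\<lambda>v :: real ^ 'u. ln (\<Sum>w\<in>UNIV. exp (- \<beta>2 * (\<Sum>u\<in>UNIV. v $ u * M u w))))"
      by (intro continuous_intros ballI less_imp_neq[THEN not_sym] sum_pos) auto
    ultimately show ?thesis
      unfolding f_def divide_inverse
      by (intro continuous_on_diff continuous_on_mult continuous_on_minus
          continuous_on_const)
  qed
  then obtain p where p: "\<And>p'. f (\<chi> u. pmf p' u) \<le> f (\<chi> u. pmf p u)"
    using pmf_attains_sup by blast
  have "\<exists>q. regularized_payoff \<beta>1 \<beta>2 M p' q = f (\<chi> u. pmf p' u) \<and>
      (\<forall>q'. f (\<chi> u. pmf p' u) \<le> regularized_payoff \<beta>1 \<beta>2 M p' q')" for p'
    by (rule regularized_payoff_attains_min[OF assms, where M = M and p = p' and ?\<beta>1.0 = \<beta>1])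
      (auto simp: f_def shannon_entropy_def)
  then show ?thesis
    using p by metis
qed

section \<open>Finite-horizon dynamic programming\<close>

text \<open>
  Packaging the continuation as a function of the actions and the next state lets a stage operator
  that knows only the current state receive a continuation that depends on the whole past.
\<close>
definition extensions :: "(('x, 'u, 'w) history \<Rightarrow> 'c) \<Rightarrow> ('x, 'u, 'w) history \<Rightarrow> 'u \<times> 'w \<times> 'x \<Rightarrow> 'c" where
  "extensions f h = (\<lambda>(u, w, x'). f (fst h @ [(snd h, u, w)], x'))"

text \<open>
  The payoff still to come at the history \<open>h\<close> when \<open>k\<close> stages remain. The operator \<open>T x p q f\<close> gives
  the value of a stage played with \<open>p\<close> and \<open>q\<close> in the state \<open>x\<close>, when \<open>f\<close> is the value of what
  follows. The number of the current stage is read off the length of the history, so that the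
  recursion makes sense at every history.
\<close>
primrec backward_value ::
  "('x \<Rightarrow> 'p \<Rightarrow> 'q \<Rightarrow> ('u \<times> 'w \<times> 'x \<Rightarrow> real) \<Rightarrow> real) \<Rightarrow> ('x \<Rightarrow> real) \<Rightarrow>
    (nat \<Rightarrow> ('x, 'u, 'w) history \<Rightarrow> 'p) \<Rightarrow> (nat \<Rightarrow> ('x, 'u, 'w) history \<Rightarrow> 'q) \<Rightarrow>
    nat \<Rightarrow> ('x, 'u, 'w) history \<Rightarrow> real" where
  "backward_value T K \<sigma> \<tau> 0 h = K (snd h)"
| "backward_value T K \<sigma> \<tau> (Suc k) h =
     T (snd h) (\<sigma> (Suc (length (fst h))) h) (\<tau> (Suc (length (fst h))) h)
       (extensions (backward_value T K \<sigma> \<tau> k) h)"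

lemma extensions_uminus: "extensions (\<lambda>h. - f h) h = (\<lambda>s. - extensions f h s)"
  by (auto simp: extensions_def)

lemma extensions_mono:
  assumes "\<And>h'. length (fst h') = Suc (length (fst h)) \<Longrightarrow> f h' \<le> g h'"
  shows "extensions f h s \<le> extensions g h s"
  using assms by (cases s) (auto simp: extensions_def)

lemma extensions_cong:
  assumes "snd h = snd h'" "length (fst h) = length (fst h')"
    and "\<And>a b. length (fst a) = Suc (length (fst h)) \<Longrightarrow> length (fst b) = Suc (length (fst h)) \<Longrightarrow>
      snd a = snd b \<Longrightarrow> f a = g b"
  shows "extensions f h = extensions g h'"
proof -
  have "f (fst h @ [(snd h, u, w)], x') = g (fst h' @ [(snd h', u, w)], x')" for u w x'
    by (rule assms(3)) (simp_all add: assms(2))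
  then show ?thesis by (simp add: extensions_def)
qed

text \<open>
  The same play seen by player 2, who maximizes the negated payoff.
\<close>
lemma backward_value_dual:
  "backward_value (\<lambda>x q p f. - T x p q (\<lambda>s. - f s)) (\<lambda>x. - K x) \<tau> \<sigma> k h =
    - backward_value T K \<sigma> \<tau> k h"
proof (induction k arbitrary: h)
  case (Suc k)
  have "backward_value (\<lambda>x q p f. - T x p q (\<lambda>s. - f s)) (\<lambda>x. - K x) \<tau> \<sigma> k =
      (\<lambda>h. - backward_value T K \<sigma> \<tau> k h)"
    by (rule ext) (rule Suc.IH)
  then show ?case by (simp add: extensions_uminus)
qed simp

lemma markov_strategiesD:
  assumes "\<sigma> \<in> markov_strategies" "snd h = snd h'" "length (fst h) = length (fst h')"
  shows "\<sigma> (Suc (length (fst h))) h = \<sigma> (Suc (length (fst h'))) h'"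
proof -
  have "\<forall>t\<ge>1. \<forall>h\<in>histories t. \<forall>h'\<in>histories t. snd h = snd h' \<longrightarrow> \<sigma> t h = \<sigma> t h'"
    using assms(1) by (simp only: markov_strategies_def mem_Collect_eq)
  from this[rule_format, of "Suc (length (fst h'))" h h'] show ?thesis
    using assms(2,3) by (simp add: histories_def)
qed

text \<open>
  Dynamic programming for the max-min problem. Once a strategy \<open>\<sigma>\<close> is fixed, player 2 faces a
  decision problem solved by backward induction: \<open>cost \<sigma>\<close> is its optimal value, and the strategy
  \<open>\<tau>s \<sigma>\<close> choosing an optimal reply at each history attains it. If \<open>\<sigma>\<close> is Markovian, then \<open>cost \<sigma>\<close>,
  and with it \<open>\<tau>s \<sigma>\<close>, depends on the current state only. On the other hand, \<open>cost \<sigma>\<close> never exceeds the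
  value \<open>val\<close> of the recursion that takes the max-min of \<open>T\<close> in each state separately, and the
  Markovian strategy \<open>\<sigma>s\<close> playing a max-min action everywhere attains this bound. Hence the same
  \<open>\<sigma>s\<close> and the same replies solve both the unrestricted and the Markovian problem.

  The functional \<open>E\<close> stands for the expectation over the initial state.
\<close>
lemma is_max_min_backward_value:
  fixes T :: "'x \<Rightarrow> 'a pmf \<Rightarrow> 'b pmf \<Rightarrow> ('u \<times> 'w \<times> 'x \<Rightarrow> real) \<Rightarrow> real"
    and K :: "'x \<Rightarrow> real" and E :: "('x \<Rightarrow> real) \<Rightarrow> real" and N :: nat
  assumes mono: "\<And>x p q f g. (\<And>s. f s \<le> g s) \<Longrightarrow> T x p q f \<le> T x p q g"
    and min: "\<And>x p f. \<exists>q. \<forall>q'. T x p q f \<le> T x p q' f"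
    and max_min: "\<And>x f. \<exists>p q. (\<forall>q'. T x p q f \<le> T x p q' f) \<and> (\<forall>p'. \<exists>q'. T x p' q' f \<le> T x p q f)"
    and E: "\<And>f g. (\<And>x. f x \<le> g x) \<Longrightarrow> E f \<le> E g"
  defines "F \<equiv> \<lambda>\<sigma> \<tau>. E (\<lambda>x. backward_value T K \<sigma> \<tau> N ([], x))"
  shows "\<exists>v. is_max_min F markov_strategies markov_strategies v \<and> is_max_min F strategies strategies v"
proof -
  (* A fixed choice of best replies: equal states, actions and continuations give equal replies, which
     is what makes the reply to a Markovian strategy Markovian. *)
  obtain reply where reply: "\<And>x p f q. T x p (reply x p f) f \<le> T x p q f"
    using min by metis
  obtain best worst where
    worst: "\<And>x f q. T x (best x f) (worst x f) f \<le> T x (best x f) q f" and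
    best: "\<And>x f p. \<exists>q. T x p q f \<le> T x (best x f) (worst x f) f"
    using max_min by metis
  define cost where "cost \<sigma> = rec_nat (\<lambda>h. K (snd h))
      (\<lambda>k c h. T (snd h) (\<sigma> (Suc (length (fst h))) h)
        (reply (snd h) (\<sigma> (Suc (length (fst h))) h) (extensions c h)) (extensions c h))"
    for \<sigma> :: "nat \<Rightarrow> ('x, 'u, 'w) history \<Rightarrow> 'a pmf"
  have cost_0: "cost \<sigma> 0 h = K (snd h)"
    and cost_Suc: "cost \<sigma> (Suc k) h = T (snd h) (\<sigma> (Suc (length (fst h))) h)
        (reply (snd h) (\<sigma> (Suc (length (fst h))) h) (extensions (cost \<sigma> k) h)) (extensions (cost \<sigma> k) h)"
    for \<sigma> k h by (simp_all add: cost_def)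
  define val where "val = rec_nat K
      (\<lambda>k v x. T x (best x (\<lambda>(u, w, x'). v x')) (worst x (\<lambda>(u, w, x'). v x')) (\<lambda>(u, w, x'). v x'))"
  have val_0: "val 0 = K"
    and val_Suc: "val (Suc k) x = T x (best x (\<lambda>(u, w, x'). val k x'))
        (worst x (\<lambda>(u, w, x'). val k x')) (\<lambda>(u, w, x'). val k x')"
    for k x by (simp_all add: val_def)
  have ext_val: "extensions (\<lambda>h. val k (snd h)) h = (\<lambda>(u, w, x'). val k x')"
    for k and h :: "('x, 'u, 'w) history"
    by (simp add: extensions_def)
  (* Before stage t, exactly N - t + 1 stages remain, so the continuation is valued with N - t. *)
  define \<tau>s where "\<tau>s \<sigma> t h = reply (snd h) (\<sigma> t h) (extensions (cost \<sigma> (N - t)) h)" for \<sigma> t h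
  define \<sigma>s where "\<sigma>s t h = best (snd h) (\<lambda>(u::'u, w::'w, x'). val (N - t) x')"
    for t and h :: "('x, 'u, 'w) history"

  have cost_le: "cost \<sigma> k h \<le> backward_value T K \<sigma> \<tau> k h" for \<sigma> \<tau> k h
  proof (induction k arbitrary: h)
    case (Suc k)
    show ?case unfolding cost_Suc backward_value.simps
      by (rule order_trans[OF reply mono]) (rule extensions_mono, rule Suc.IH)
  qed (simp add: cost_0)
  have cost_eq: "backward_value T K \<sigma> (\<tau>s \<sigma>) k h = cost \<sigma> k h" if "length (fst h) + k = N" for \<sigma> k h
    using that
  proof (induction k arbitrary: h)
    case (Suc k)
    have "extensions (backward_value T K \<sigma> (\<tau>s \<sigma>) k) h = extensions (cost \<sigma> k) h"
      using Suc by (auto simp: extensions_def fun_eq_iff)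
    moreover have "N - Suc (length (fst h)) = k" using Suc.prems by simp
    then have "\<tau>s \<sigma> (Suc (length (fst h))) h =
        reply (snd h) (\<sigma> (Suc (length (fst h))) h) (extensions (cost \<sigma> k) h)"
      by (simp add: \<tau>s_def)
    ultimately show ?case by (simp add: cost_Suc)
  qed (simp add: cost_0)
  have cost_markov: "cost \<sigma> k h = cost \<sigma> k h'"
    if "\<sigma> \<in> markov_strategies" "snd h = snd h'" "length (fst h) = length (fst h')" for \<sigma> k h h'
    using that(2,3)
  proof (induction k arbitrary: h h')
    case (Suc k)
    have "extensions (cost \<sigma> k) h = extensions (cost \<sigma> k) h'"
      using Suc.prems by (intro extensions_cong) (auto intro: Suc.IH)
    then show ?case
      using markov_strategiesD[OF that(1) Suc.prems] Suc.prems by (simp add: cost_Suc)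
  qed (simp add: cost_0)
  have \<tau>s_markov: "\<tau>s \<sigma> \<in> markov_strategies" if "\<sigma> \<in> markov_strategies" for \<sigma>
    unfolding markov_strategies_def
  proof (intro CollectI allI ballI impI)
    fix t and h h' :: "('x, 'u, 'w) history"
    assume t: "1 \<le> t" and h: "h \<in> histories t" "h' \<in> histories t" "snd h = snd h'"
    then have len: "length (fst h) = length (fst h')" by (simp add: histories_def)
    have "extensions (cost \<sigma> (N - t)) h = extensions (cost \<sigma> (N - t)) h'"
      by (intro extensions_cong h(3) len cost_markov[OF that]) simp_all
    moreover have "\<sigma> t h = \<sigma> t h'" using that t h unfolding markov_strategies_def by blast
    ultimately show "\<tau>s \<sigma> t h = \<tau>s \<sigma> t h'" using h by (simp add: \<tau>s_def)
  qed
  have \<sigma>s_markov: "\<sigma>s \<in> markov_strategies"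
    by (auto simp: markov_strategies_def \<sigma>s_def)
  have cost_le_val: "cost \<sigma> k h \<le> val k (snd h)" for \<sigma> k h
  proof (induction k arbitrary: h)
    case (Suc k)
    let ?f = "\<lambda>(u::'u, w::'w, x'). val k x'"
    let ?p = "\<sigma> (Suc (length (fst h))) h"
    obtain q where q: "T (snd h) ?p q ?f \<le> val (Suc k) (snd h)"
      unfolding val_Suc using best by blast
    have "cost \<sigma> (Suc k) h \<le> T (snd h) ?p q (extensions (cost \<sigma> k) h)"
      unfolding cost_Suc by (rule reply)
    also have "\<dots> \<le> T (snd h) ?p q ?f"
      unfolding ext_val[symmetric, of _ h] by (intro mono extensions_mono Suc.IH)
    finally show ?case using q by linarith
  qed (simp add: cost_0 val_0)
  have cost_eq_val: "cost \<sigma>s k h = val k (snd h)" if "length (fst h) + k = N" for k h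
    using that
  proof (induction k arbitrary: h)
    case (Suc k)
    have ext: "extensions (cost \<sigma>s k) h = (\<lambda>(u, w, x'). val k x')"
      using Suc by (auto simp: extensions_def fun_eq_iff)
    have "N - Suc (length (fst h)) = k" using Suc.prems by simp
    then have "\<sigma>s (Suc (length (fst h))) h = best (snd h) (\<lambda>(u, w, x'). val k x')"
      by (simp add: \<sigma>s_def)
    then show ?case
      unfolding cost_Suc ext val_Suc by (simp only:) (intro antisym reply worst)
  qed (simp add: cost_0 val_0)

  (* g \<sigma> is the minimum of F \<sigma>, both over all replies and, for a Markovian \<sigma>, over the Markovian ones. *)
  define g where "g \<sigma> = E (\<lambda>x. cost \<sigma> N ([], x))" for \<sigma>
  have g_le: "g \<sigma> \<le> F \<sigma> \<tau>" for \<sigma> \<tau>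
    unfolding g_def F_def by (intro E cost_le)
  have g_eq: "F \<sigma> (\<tau>s \<sigma>) = g \<sigma>" for \<sigma>
    unfolding g_def F_def by (simp add: cost_eq)
  have g_max: "g \<sigma> \<le> g \<sigma>s" for \<sigma>
    unfolding g_def using cost_le_val[of \<sigma> N "([], x)" for x] by (intro E) (simp add: cost_eq_val)
  have "is_max_min F A B (g \<sigma>s)" if "\<sigma>s \<in> A" "\<And>\<sigma>. \<sigma> \<in> A \<Longrightarrow> \<tau>s \<sigma> \<in> B" for A B
    unfolding is_max_min_def
  proof (intro exI[of _ g] conjI ballI)
    show "is_max_over g A (g \<sigma>s)"
      unfolding is_max_over_def using that(1) g_max by blast
    fix \<sigma> assume "\<sigma> \<in> A"
    then show "is_min_over (F \<sigma>) B (g \<sigma>)"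
      unfolding is_min_over_def using that(2) g_le g_eq[symmetric] by blast
  qed
  then show ?thesis using \<sigma>s_markov \<tau>s_markov by blast
qed

lemma is_max_over_uminus: "is_max_over (\<lambda>a. - f a) A (- v) \<longleftrightarrow> is_min_over f A v"
  unfolding is_max_over_def is_min_over_def by (simp add: image_iff)

lemma is_min_over_uminus: "is_min_over (\<lambda>a. - f a) A (- v) \<longleftrightarrow> is_max_over f A v"
  unfolding is_max_over_def is_min_over_def by (simp add: image_iff)

lemma is_min_max_iff_dual:
  "is_min_max F A B v \<longleftrightarrow> is_max_min (\<lambda>\<tau> \<sigma>. - F \<sigma> \<tau>) B A (- v)"
proof
  assume "is_min_max F A B v"
  then obtain g where "\<forall>\<tau>\<in>B. is_max_over (\<lambda>\<sigma>. F \<sigma> \<tau>) A (g \<tau>)" "is_min_over g B v"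
    unfolding is_min_max_def by blast
  then show "is_max_min (\<lambda>\<tau> \<sigma>. - F \<sigma> \<tau>) B A (- v)"
    unfolding is_max_min_def
    by (intro exI[of _ "\<lambda>\<tau>. - g \<tau>"]) (simp add: is_max_over_uminus is_min_over_uminus)
next
  assume "is_max_min (\<lambda>\<tau> \<sigma>. - F \<sigma> \<tau>) B A (- v)"
  then obtain g where g: "\<forall>\<tau>\<in>B. is_min_over (\<lambda>\<sigma>. - F \<sigma> \<tau>) A (g \<tau>)" "is_max_over g B (- v)"
    unfolding is_max_min_def by blast
  have "is_max_over (\<lambda>\<sigma>. F \<sigma> \<tau>) A (- g \<tau>)" if "\<tau> \<in> B" for \<tau>
    using g(1) that is_min_over_uminus[of "\<lambda>\<sigma>. F \<sigma> \<tau>" A "- g \<tau>"] by simp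
  moreover have "is_min_over (\<lambda>\<tau>. - g \<tau>) B v"
    using g(2) is_max_over_uminus[of "\<lambda>\<tau>. - g \<tau>" B v] by simp
  ultimately show "is_min_max F A B v"
    unfolding is_min_max_def by (intro exI[of _ "\<lambda>\<tau>. - g \<tau>"]) simp
qed

section \<open>The evaluation function as a backward recursion\<close>

lemma expectation_bind_finite:
  fixes h :: "'b \<Rightarrow> real"
  assumes "finite (set_pmf p)" "\<And>a. finite (set_pmf (f a))"
  shows "measure_pmf.expectation (bind_pmf p f) h =
    measure_pmf.expectation p (\<lambda>a. measure_pmf.expectation (f a) h)"
  using assms
  by (simp add: pmf_expectation_bind[of "set_pmf p"] integral_measure_pmf[of "set_pmf p"])

lemma expectation_finite_type:
  fixes p :: "'a::finite pmf" and f :: "'a \<Rightarrow> real"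
  shows "measure_pmf.expectation p f = (\<Sum>a\<in>UNIV. pmf p a * f a)"
  by (subst integral_measure_pmf[of UNIV]) auto

lemma expectation_cong_pmf:
  fixes f g :: "'a \<Rightarrow> real"
  assumes "\<And>a. a \<in> set_pmf p \<Longrightarrow> f a = g a"
  shows "measure_pmf.expectation p f = measure_pmf.expectation p g"
  using assms by (intro integral_cong_AE) (auto simp: AE_measure_pmf_iff)

lemma finite_set_history_law:
  fixes P :: "'x::finite \<Rightarrow> 'u::finite \<Rightarrow> 'w::finite \<Rightarrow> 'x pmf"
  shows "finite (set_pmf (history_law P \<mu> \<sigma> \<tau> n))"
  by (induction n) auto

lemma length_history_law:
  "h \<in> set_pmf (history_law P \<mu> \<sigma> \<tau> n) \<Longrightarrow> length (fst h) = n"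
  by (induction n arbitrary: h) auto

text \<open>
  If \<open>A\<close> is drawn from the kernel \<open>\<kappa>\<close> given \<open>B\<close>, then the conditional mass in the definition of
  the entropy is \<open>\<kappa>\<close> itself wherever \<open>B\<close> has positive mass, and the conditional entropy becomes an
  average of ordinary entropies. Each causal entropy thus
  becomes an expected sum of the entropies of the prescribed mixed actions.
\<close>
lemma cond_entropy_pmf_kernel:
  fixes A :: "'z \<Rightarrow> 'a::finite" and B :: "'z \<Rightarrow> 'b::countable"
  assumes fin: "finite (set_pmf \<rho>)"
    and joint: "map_pmf (\<lambda>z. (A z, B z)) p = bind_pmf \<rho> (\<lambda>b. map_pmf (\<lambda>a. (a, b)) (\<kappa> b))"
  shows "cond_entropy_pmf p A B = measure_pmf.expectation \<rho> (\<lambda>b. shannon_entropy (\<kappa> b))"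
proof -
  let ?J = "bind_pmf \<rho> (\<lambda>b. map_pmf (\<lambda>a. (a, b)) (\<kappa> b))"
  have "map_pmf B p = map_pmf snd (map_pmf (\<lambda>z. (A z, B z)) p)"
    by (simp add: pmf.map_comp o_def)
  also have "\<dots> = \<rho>"
    unfolding joint by (simp add: map_bind_pmf pmf.map_comp o_def map_pmf_const bind_return_pmf')
  finally have B: "map_pmf B p = \<rho>" .
  have J: "pmf ?J (a, b) = pmf \<rho> b * pmf (\<kappa> b) a" for a b
  proof -
    have "pmf (map_pmf (\<lambda>a. (a, b')) (\<kappa> b')) (a, b) = indicator {b} b' * pmf (\<kappa> b) a" for b'
    proof (cases "b' = b")
      case True
      have "inj (\<lambda>a. (a, b))" by (simp add: inj_on_def)
      from pmf_map_inj'[OF this, of "\<kappa> b" a] True show ?thesis by simp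
    next
      case False
      then show ?thesis by (auto simp: pmf_eq_0_set_pmf)
    qed
    then show ?thesis by (simp add: pmf_bind measure_pmf_single)
  qed
  have "cond_entropy_pmf p A B =
      - measure_pmf.expectation ?J (\<lambda>(a, b). ln (pmf ?J (a, b) / pmf \<rho> b))"
    unfolding cond_entropy_pmf_eq joint B ..
  also have "\<dots> = - measure_pmf.expectation \<rho> (\<lambda>b. \<Sum>a\<in>UNIV. pmf (\<kappa> b) a * ln (pmf ?J (a, b) / pmf \<rho> b))"
    by (subst expectation_bind_finite) (auto simp: fin expectation_finite_type)
  also have "\<dots> = - measure_pmf.expectation \<rho> (\<lambda>b. - shannon_entropy (\<kappa> b))"
    by (rule arg_cong[of _ _ uminus], rule expectation_cong_pmf)
      (simp add: J shannon_entropy_def set_pmf_iff)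
  finally show ?thesis by simp
qed

text \<open>
  Later stages do not influence the law of what was observed and played at stage \<open>n + 1\<close>: each of them
  only appends an entry to the record and then averages over it.
\<close>
lemma stage_law:
  assumes "n < N"
  shows "map_pmf (\<lambda>z. (history_at (Suc n) z, action1_at (Suc n) z, action2_at (Suc n) z))
      (history_law P \<mu> \<sigma> \<tau> N) =
    bind_pmf (history_law P \<mu> \<sigma> \<tau> n) (\<lambda>h. bind_pmf (\<sigma> (Suc n) h) (\<lambda>u.
      map_pmf (\<lambda>w. (h, u, w)) (\<tau> (Suc n) h)))"
  (is "map_pmf ?S _ = ?J")
proof -
  (* The appended entry is read by the stage variables exactly if it is the entry of stage n + 1. *)
  have ext: "?S (fst h @ [(snd h, u, w)], x') = (if length (fst h) = n then (h, u, w) else ?S h)"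
    if "length (fst h) \<ge> n" for h u w x'
    using that by (auto simp: history_at_def action1_at_def action2_at_def nth_append)
  have one_more: "map_pmf ?S (history_law P \<mu> \<sigma> \<tau> (Suc m)) =
      bind_pmf (history_law P \<mu> \<sigma> \<tau> m) (\<lambda>h. bind_pmf (\<sigma> (Suc m) h) (\<lambda>u.
        bind_pmf (\<tau> (Suc m) h) (\<lambda>w. return_pmf (if m = n then (h, u, w) else ?S h))))"
    if "m \<ge> n" for m
    unfolding history_law.simps map_bind_pmf pmf.map_comp o_def
    using that
    by (intro bind_pmf_cong refl)
      (auto simp: ext length_history_law map_pmf_const simp del: history_law.simps)
  from Suc_leI[OF assms] show ?thesis
  proof (induction N rule: dec_induct)
    case base
    show ?case unfolding one_more[OF order_refl] by (simp add: map_pmf_def)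
  next
    case (step m)
    have "map_pmf ?S (history_law P \<mu> \<sigma> \<tau> (Suc m)) = map_pmf ?S (history_law P \<mu> \<sigma> \<tau> m)"
      using step.hyps(1) by (subst one_more) (auto simp: map_pmf_def simp del: history_law.simps)
    then show ?case using step.IH by simp
  qed
qed

definition stage_payoff ::
  "('x::finite \<Rightarrow> 'u::finite \<Rightarrow> 'w::finite \<Rightarrow> 'x pmf) \<Rightarrow> ('x \<Rightarrow> 'u \<Rightarrow> 'w \<Rightarrow> real) \<Rightarrow> real \<Rightarrow> real \<Rightarrow>
    'x \<Rightarrow> 'u pmf \<Rightarrow> 'w pmf \<Rightarrow> ('u \<times> 'w \<times> 'x \<Rightarrow> real) \<Rightarrow> real" where
  "stage_payoff P R \<beta>1 \<beta>2 x p q f =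
     regularized_payoff \<beta>1 \<beta>2
       (\<lambda>u w. R x u w + measure_pmf.expectation (P x u w) (\<lambda>x'. f (u, w, x'))) p q"

text \<open>
  The law of the complete record enters only through its marginals at single stages, and each
  stage contributes the regularized payoff of the mixed actions used there.
\<close>
lemma evaluation_eq_sum_stages:
  fixes P :: "'x::finite \<Rightarrow> 'u::finite \<Rightarrow> 'w::finite \<Rightarrow> 'x pmf"
    and R :: "'x \<Rightarrow> 'u \<Rightarrow> 'w \<Rightarrow> real" and K :: "'x \<Rightarrow> real" and \<beta>1 \<beta>2 :: real
    and \<mu> :: "'x pmf" and \<sigma> :: "('x, 'u, 'w, 'u) strategy" and \<tau> :: "('x, 'u, 'w, 'w) strategy"
  defines "law \<equiv> history_law P \<mu> \<sigma> \<tau>"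
  shows "evaluation P R K \<mu> \<beta>1 \<beta>2 N \<sigma> \<tau> =
    (\<Sum>n<N. measure_pmf.expectation (law n)
       (\<lambda>h. regularized_payoff \<beta>1 \<beta>2 (R (snd h)) (\<sigma> (Suc n) h) (\<tau> (Suc n) h)))
    + measure_pmf.expectation (law N) (\<lambda>h. K (snd h))"
proof -
  note fin = finite_set_history_law[of P \<mu> \<sigma> \<tau>, folded law_def]
  note stage = stage_law[of _ N P \<mu> \<sigma> \<tau>, folded law_def]
  have payoff: "measure_pmf.expectation (law N)
        (\<lambda>h. R (state_at (Suc n) h) (action1_at (Suc n) h) (action2_at (Suc n) h)) =
      measure_pmf.expectation (law n) (\<lambda>h. bilinear_payoff (R (snd h)) (\<sigma> (Suc n) h) (\<tau> (Suc n) h))"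
    (is "?L = ?Rhs") if "n < N" for n
  proof -
    have "?L = measure_pmf.expectation (map_pmf (\<lambda>z. (history_at (Suc n) z, action1_at (Suc n) z,
        action2_at (Suc n) z)) (law N)) (\<lambda>(h, u, w). R (snd h) u w)"
      by (simp add: state_at_def)
    also have "\<dots> = ?Rhs"
      unfolding stage[OF that]
      by (simp add: expectation_bind_finite fin expectation_finite_type bilinear_payoff_def
          sum_distrib_left mult.assoc)
    finally show ?thesis .
  qed
  have ent1: "cond_entropy_pmf (law N) (action1_at (Suc n)) (history_at (Suc n)) =
      measure_pmf.expectation (law n) (\<lambda>h. shannon_entropy (\<sigma> (Suc n) h))" if "n < N" for n
  proof (rule cond_entropy_pmf_kernel[OF fin])
    have "map_pmf (\<lambda>(h, u, w). (u, h)) (map_pmf (\<lambda>z. (history_at (Suc n) z, action1_at (Suc n) z,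
        action2_at (Suc n) z)) (law N)) = bind_pmf (law n) (\<lambda>h. map_pmf (\<lambda>u. (u, h)) (\<sigma> (Suc n) h))"
      unfolding stage[OF that] map_bind_pmf
      by (simp add: pmf.map_comp o_def map_pmf_const) (simp add: map_pmf_def)
    then show "map_pmf (\<lambda>z. (action1_at (Suc n) z, history_at (Suc n) z)) (law N) =
        bind_pmf (law n) (\<lambda>h. map_pmf (\<lambda>u. (u, h)) (\<sigma> (Suc n) h))"
      by (simp add: pmf.map_comp o_def)
  qed
  have ent2: "cond_entropy_pmf (law N) (action2_at (Suc n)) (history_at (Suc n)) =
      measure_pmf.expectation (law n) (\<lambda>h. shannon_entropy (\<tau> (Suc n) h))" if "n < N" for n
  proof (rule cond_entropy_pmf_kernel[OF fin])
    have "map_pmf (\<lambda>(h, u, w). (w, h)) (map_pmf (\<lambda>z. (history_at (Suc n) z, action1_at (Suc n) z,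
        action2_at (Suc n) z)) (law N)) = bind_pmf (law n) (\<lambda>h. map_pmf (\<lambda>w. (w, h)) (\<tau> (Suc n) h))"
      unfolding stage[OF that] map_bind_pmf
      by (simp add: pmf.map_comp o_def)
    then show "map_pmf (\<lambda>z. (action2_at (Suc n) z, history_at (Suc n) z)) (law N) =
        bind_pmf (law n) (\<lambda>h. map_pmf (\<lambda>w. (w, h)) (\<tau> (Suc n) h))"
      by (simp add: pmf.map_comp o_def)
  qed
  have final: "measure_pmf.expectation (law N) (\<lambda>h. K (state_at (N + 1) h)) =
      measure_pmf.expectation (law N) (\<lambda>h. K (snd h))"
    by (rule expectation_cong_pmf)
      (auto simp: law_def state_at_def history_at_def nth_append dest: length_history_law)
  have int: "integrable (measure_pmf (law n)) f" for n and f :: "_ \<Rightarrow> real"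
    by (rule integrable_measure_pmf_finite[OF fin])
  have shift: "sum f {1..N} = (\<Sum>n<N. f (Suc n))" for f :: "nat \<Rightarrow> real"
    by (simp add: sum.atLeast1_atMost_eq)
  show ?thesis
    unfolding evaluation_def Let_def law_def[symmetric] final shift regularized_payoff_def
    by (simp add: payoff ent1 ent2 int sum.distrib sum_subtractf sum_divide_distrib)
qed

text \<open>
  Playing one more stage turns the expected payoff still to come into the stage payoff plus the
  expected payoff still to come afterwards. The case \<open>n = N\<close> identifies the forward sum over the stages
  with the backward recursion.
\<close>
lemma expected_backward_value:
  fixes P :: "'x::finite \<Rightarrow> 'u::finite \<Rightarrow> 'w::finite \<Rightarrow> 'x pmf"
    and R :: "'x \<Rightarrow> 'u \<Rightarrow> 'w \<Rightarrow> real" and K :: "'x \<Rightarrow> real" and \<beta>1 \<beta>2 :: real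
    and \<mu> :: "'x pmf" and \<sigma> :: "('x, 'u, 'w, 'u) strategy" and \<tau> :: "('x, 'u, 'w, 'w) strategy"
  assumes "n \<le> N"
  defines "law \<equiv> history_law P \<mu> \<sigma> \<tau>"
  defines "V \<equiv> backward_value (stage_payoff P R \<beta>1 \<beta>2) K \<sigma> \<tau>"
  shows "measure_pmf.expectation (law 0) (V N) =
    (\<Sum>i<n. measure_pmf.expectation (law i)
       (\<lambda>h. regularized_payoff \<beta>1 \<beta>2 (R (snd h)) (\<sigma> (Suc i) h) (\<tau> (Suc i) h)))
    + measure_pmf.expectation (law n) (V (N - n))"
  using assms(1)
proof (induction n)
  case (Suc n)
  note fin = finite_set_history_law[of P \<mu> \<sigma> \<tau>, folded law_def]
  have int: "integrable (measure_pmf (law n)) f" for f :: "_ \<Rightarrow> real"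
    by (rule integrable_measure_pmf_finite[OF fin])
  (* The bilinear part of the payoff is additive, so the stage payoff ?r separates from the
     continuation ?c, whose mean is an expectation over the next history. *)
  let ?r = "\<lambda>h. regularized_payoff \<beta>1 \<beta>2 (R (snd h)) (\<sigma> (Suc n) h) (\<tau> (Suc n) h)"
  let ?c = "\<lambda>h. bilinear_payoff (\<lambda>u w. measure_pmf.expectation (P (snd h) u w)
      (\<lambda>x'. V (N - Suc n) (fst h @ [(snd h, u, w)], x'))) (\<sigma> (Suc n) h) (\<tau> (Suc n) h)"
  have "N - n = Suc (N - Suc n)" using Suc.prems by simp
  then have "measure_pmf.expectation (law n) (V (N - n)) = measure_pmf.expectation (law n) (\<lambda>h. ?r h + ?c h)"
    by (intro expectation_cong_pmf)
      (auto simp: V_def law_def stage_payoff_def regularized_payoff_def bilinear_payoff_add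
        extensions_def dest!: length_history_law)
  also have "\<dots> = measure_pmf.expectation (law n) ?r + measure_pmf.expectation (law n) ?c"
    by (simp add: int)
  also have "measure_pmf.expectation (law n) ?c = measure_pmf.expectation (law (Suc n)) (V (N - Suc n))"
    unfolding law_def history_law.simps
    by (subst expectation_bind_finite, simp add: finite_set_history_law, simp)+
      (simp add: expectation_bind_finite expectation_finite_type bilinear_payoff_def sum_distrib_left mult.assoc)
  finally show ?case using Suc by simp
qed simp

lemma evaluation_eq_backward_value:
  fixes P :: "'x::finite \<Rightarrow> 'u::finite \<Rightarrow> 'w::finite \<Rightarrow> 'x pmf"
  shows "evaluation P R K \<mu> \<beta>1 \<beta>2 N \<sigma> \<tau> =
    measure_pmf.expectation \<mu> (\<lambda>x. backward_value (stage_payoff P R \<beta>1 \<beta>2) K \<sigma> \<tau> N ([], x))"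
proof -
  have "backward_value (stage_payoff P R \<beta>1 \<beta>2) K \<sigma> \<tau> 0 = (\<lambda>h. K (snd h))"
    by (rule ext) simp
  then show ?thesis
    using expected_backward_value[of N N P \<mu> \<sigma> \<tau> R \<beta>1 \<beta>2 K]
    by (simp add: evaluation_eq_sum_stages)
qed

lemma stage_payoff_mono:
  "(\<And>s. f s \<le> g s) \<Longrightarrow> stage_payoff P R \<beta>1 \<beta>2 x p q f \<le> stage_payoff P R \<beta>1 \<beta>2 x p q g"
  unfolding stage_payoff_def regularized_payoff_def
  by (intro add_right_mono diff_right_mono bilinear_payoff_mono add_left_mono integral_mono
      integrable_measure_pmf_finite) auto

theorem proposition1:
  fixes P :: "'x::finite \<Rightarrow> 'u::finite \<Rightarrow> 'w::finite \<Rightarrow> 'x pmf"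
    and R :: "'x \<Rightarrow> 'u \<Rightarrow> 'w \<Rightarrow> real"
    and K :: "'x \<Rightarrow> real"
    and \<mu> :: "'x pmf"
    and \<beta>1 \<beta>2 :: real
    and N :: nat
  assumes "N \<ge> 1" and "\<beta>1 > 0" and "\<beta>2 > 0"
  defines "\<Phi> \<equiv> evaluation P R K \<mu> \<beta>1 \<beta>2 N"
  shows "(\<exists>v. is_max_min \<Phi> markov_strategies markov_strategies v
             \<and> is_max_min \<Phi> strategies strategies v) \<and>
         (\<exists>v. is_min_max \<Phi> markov_strategies markov_strategies v
             \<and> is_min_max \<Phi> strategies strategies v)"
proof
  let ?T = "stage_payoff P R \<beta>1 \<beta>2"
  let ?T' = "\<lambda>x q p f. - ?T x p q (\<lambda>s. - f s)"
  let ?E = "\<lambda>f :: 'x \<Rightarrow> real. measure_pmf.expectation \<mu> f"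
  have E_mono: "?E f \<le> ?E g" if "\<And>x. f x \<le> g x" for f g
    using that by (intro integral_mono integrable_measure_pmf_finite) auto
  have \<Phi>: "\<Phi> = (\<lambda>\<sigma> \<tau>. ?E (\<lambda>x. backward_value ?T K \<sigma> \<tau> N ([], x)))"
    unfolding \<Phi>_def by (intro ext evaluation_eq_backward_value)
  show "\<exists>v. is_max_min \<Phi> markov_strategies markov_strategies v \<and> is_max_min \<Phi> strategies strategies v"
    unfolding \<Phi>
  proof (rule is_max_min_backward_value[of ?T ?E])
    show "\<exists>q. \<forall>q'. ?T x p q f \<le> ?T x p q' f" for x p f
      unfolding stage_payoff_def by (rule regularized_payoff_min[OF assms(3)])
    show "\<exists>p q. (\<forall>q'. ?T x p q f \<le> ?T x p q' f) \<and> (\<forall>p'. \<exists>q'. ?T x p' q' f \<le> ?T x p q f)" for x f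
      unfolding stage_payoff_def by (rule regularized_payoff_max_min[OF assms(3)])
  qed (rule stage_payoff_mono E_mono; assumption)+
  have dual: "(\<lambda>\<tau> \<sigma>. - \<Phi> \<sigma> \<tau>) = (\<lambda>\<tau> \<sigma>. ?E (\<lambda>x. backward_value ?T' (\<lambda>x. - K x) \<tau> \<sigma> N ([], x)))"
    unfolding \<Phi> backward_value_dual by simp
  (* Seen from player 2, a stage is again a regularized matrix game, with the roles of the two inverse
     temperatures exchanged, so the same two facts about optimal actions apply. *)
  have swap: "?T' x q p f = regularized_payoff \<beta>2 \<beta>1
      (\<lambda>w u. - (R x u w + measure_pmf.expectation (P x u w) (\<lambda>x'. - f (u, w, x')))) q p" for x q p f
    unfolding regularized_payoff_swap stage_payoff_def ..
  have "\<exists>v. is_max_min (\<lambda>\<tau> \<sigma>. - \<Phi> \<sigma> \<tau>) markov_strategies markov_strategies v \<and>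
      is_max_min (\<lambda>\<tau> \<sigma>. - \<Phi> \<sigma> \<tau>) strategies strategies v"
    unfolding dual
  proof (rule is_max_min_backward_value[of ?T' ?E])
    show "?T' x q p f \<le> ?T' x q p g" if "\<And>s. f s \<le> g s" for x q p f g
      using that by (simp add: stage_payoff_mono)
    show "\<exists>p. \<forall>p'. ?T' x q p f \<le> ?T' x q p' f" for x q f
      unfolding swap by (rule regularized_payoff_min[OF assms(2)])
    show "\<exists>q p. (\<forall>p'. ?T' x q p f \<le> ?T' x q p' f) \<and> (\<forall>q'. \<exists>p'. ?T' x q' p' f \<le> ?T' x q p f)" for x f
      unfolding swap by (rule regularized_payoff_max_min[OF assms(2)])
  qed (rule E_mono)
  then obtain v where "is_max_min (\<lambda>\<tau> \<sigma>. - \<Phi> \<sigma> \<tau>) markov_strategies markov_strategies v"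
      "is_max_min (\<lambda>\<tau> \<sigma>. - \<Phi> \<sigma> \<tau>) strategies strategies v"
    by blast
  then show "\<exists>v. is_min_max \<Phi> markov_strategies markov_strategies v \<and> is_min_max \<Phi> strategies strategies v"
    unfolding is_min_max_iff_dual by (intro exI[of _ "- v"]) simp
qed

end
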